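(* Let $[ES]$ stand for either one of the two encodings $[ES2]$ or $[ES1]$ of flat braids on $3$ strands. (1) The column of alternating row sums $[ES][\pm]_{k\times 1}$ is a flat braid invariant; that is, if two flat braids on $3$ strands, of lengths $k$ and $k'$, are equal as group elements (represent the same permutation), then the columns $[ES][\pm]_{k\times 1}$ and $[ES][\pm]_{k'\times 1}$ computed from their respective encodings are equal. (2) A flat braid on $3$ strands of length $k$ is trivial if and only if $[ES][\pm]_{k\times 1}=[0]_{3\times 1}$, i.e. the alternating sum of each row of $[ES]$ is $0$.
   Context: A flat braid on $3$ strands of length $k\ge 0$ means a word $s_{i_1}\cdots s_{i_k}$, $i_t\in\{1,2\}$, where $s_1=(1\;2)$ and $s_2=(2\;3)$ are the adjacent transpositions in the symmetric group $\mathfrak{S}_3$ (equivalently, the braid-like diagram without over/under information it describes). Two flat braids are equal if they express the same permutation in $\mathfrak{S}_3$ (equivalently, they are related by the flat second and third Reidemeister moves, i.e. inserting/removing $s_is_i$ and replacing $s_1s_2s_1\leftrightarrow s_2s_1s_2$); a flat braid is trivial if the permutation it expresses is the identity. A quantity is a flat braid invariant if it takes the same value on equal flat braids. Strands are labelled $1,2,3$ by their positions (top to bottom) at the left end. Put $a_0=(1,2,3)$ and let $a_t$ be obtained from $a_{t-1}$ by swapping the entries in positions $i_t$ and $i_t+1$. The $t$-th crossing involves the two strands $a_{t-1}(i_t)$ and $a_{t-1}(i_t+1)$. Encoding $[ES2]$ of a flat braid: the $3\times k$ matrix whose $t$-th column has entry $1$ in the two rows indexed by the strands involved in the $t$-th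 crossing and $0$ in the remaining row. Encoding $[ES1]$ of a flat braid: the $3\times k$ matrix whose rows $1,2,3$ correspond to the pairs of strands $\{1,2\}$, $\{2,3\}$, $\{3,1\}$ respectively; the $t$-th column has a single non-zero entry, equal to $1$, in the row of the pair of strands crossing at the $t$-th crossing. $[\pm]_{k\times 1}$ is the column whose $t$-th entry is $(-1)^{t+1}$, so $M[\pm]_{k\times 1}$ is the column of alternating sums of rows of $M$ (zero if $k=0$). $[0]_{3\times 1}$ is the zero column. *)

theory Defs
  imports "Jordan_Normal_Form.Matrix" "HOL-Combinatorics.Permutations"
begin

definition flat_braid :: "nat list \<Rightarrow> bool" where
  "flat_braid w \<longleftrightarrow> set w \<subseteq> {1, 2}"

definition adj :: "nat \<Rightarrow> nat \<Rightarrow> nat" where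
  "adj i = Transposition.transpose i (i + 1)"

(* The product of the letters in reading order, composed as functions. The opposite
   composition order gives the inverse permutation, so equality and triviality of flat
   braids do not depend on this choice. Elements of the symmetric group on {1,2,3} are
   functions on nat that fix everything outside {1,2,3}. *)
definition braid_perm :: "nat list \<Rightarrow> nat \<Rightarrow> nat" where
  "braid_perm w = foldr (\<lambda>i p. adj i \<circ> p) w id"

lemma braid_perm_permutes:
  assumes "flat_braid w"
  shows "braid_perm w permutes {1..3}"
  using assms
proof (induction w)
  case Nil
  then show ?case by (simp add: braid_perm_def permutes_def)
next
  case (Cons i w)
  have "adj i permutes {1..3}"
    using Cons.prems unfolding adj_def flat_braid_def
    by (intro permutes_swap_id) auto
  moreover have "braid_perm w permutes {1..3}"
    using Cons by (simp add: flat_braid_def)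
  ultimately have "adj i \<circ> braid_perm w permutes {1..3}"
    by (rule permutes_compose[rotated])
  moreover have "braid_perm (i # w) = adj i \<circ> braid_perm w"
    by (simp add: braid_perm_def)
  ultimately show ?case by (simp only:)
qed

definition braid_equal :: "nat list \<Rightarrow> nat list \<Rightarrow> bool" where
  "braid_equal w w' \<longleftrightarrow> braid_perm w = braid_perm w'"

definition trivial_braid :: "nat list \<Rightarrow> bool" where
  "trivial_braid w \<longleftrightarrow> braid_perm w = id"

(* strand_at w t p is the label of the strand in position p after the first t crossings;
   one more crossing exchanges the entries in positions w ! t and w ! t + 1. *)
primrec strand_at :: "nat list \<Rightarrow> nat \<Rightarrow> nat \<Rightarrow> nat" where
  "strand_at w 0 = (\<lambda>p. p)"
| "strand_at w (Suc t) =
     (strand_at w t)(w ! t := strand_at w t (w ! t + 1), w ! t + 1 := strand_at w t (w ! t))"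

(* Positions and strand labels count from 1; crossings and matrix indices count from 0. *)
definition crossing :: "nat list \<Rightarrow> nat \<Rightarrow> nat set" where
  "crossing w t = {strand_at w t (w ! t), strand_at w t (w ! t + 1)}"

definition ES2 :: "nat list \<Rightarrow> int mat" where
  "ES2 w = mat 3 (length w) (\<lambda>(r, t). if r + 1 \<in> crossing w t then 1 else 0)"

definition ES1 :: "nat list \<Rightarrow> int mat" where
  "ES1 w = mat 3 (length w)
     (\<lambda>(r, t). if crossing w t = [{1, 2}, {2, 3}, {3, 1}] ! r then 1 else 0)"

(* Since column indices count from 0, the sign (-1)^(t+1) becomes (-1)^t. *)
definition alt_col :: "nat \<Rightarrow> int mat" where
  "alt_col k = mat k 1 (\<lambda>(t, _). (- 1) ^ t)"

end

theory Submission
  imports Defs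
begin

text \<open>
  A crossing of the strands \<open>a\<close> and \<open>b\<close> reverses their relative order and that of no other pair.
  Hence, for each pair, its crossings alternate between reversing the original order and restoring
  it. The point is that the sign \<open>(- 1) ^ t\<close>, which only sees the place of a crossing in the
  whole word, tells these two kinds of crossing apart. Each crossing changes the number of inverted
  pairs by one, so \<open>(- 1) ^ t\<close> is the sign of the current arrangement; on the other hand, when
  \<open>a\<close> and \<open>b\<close> are adjacent, the third strand lies on the same side of both, so the pairs that
  it forms with \<open>a\<close> and \<open>b\<close> contribute a fixed sign, and the parity of the arrangement
  determines the order of \<open>a\<close> and \<open>b\<close> (\<open>even_length_iff_not_inverted\<close>).

  The pairs are oriented cyclically, as \<open>(1, 2)\<close>, \<open>(2, 3)\<close>, \<open>(3, 1)\<close>, because the sign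
  rule is then the same for all three. The alternating sum over the crossings of a pair
  telescopes to the inversion indicator of the final arrangement minus that of the initial one
  (\<open>pair_sum_eq_inversion_change\<close>). It is therefore a function of the permutation. If all three
  sums vanish, the strands end in their original order, and the permutation is the identity.

  The rows of \<open>ES1\<close> have these three numbers as alternating sums; the rows of \<open>ES2\<close> have the sums
  of two of them. Passing from the first column to the second is an injective linear map, so both
  encodings carry the same information.
\<close>

(* The prefix inv is meant as the inverse function, not as the inverse in a group structure. *)
unbundle no m_inv_syntax

section \<open>Arrangements of the strands\<close>

lemma braid_perm_Cons: "braid_perm (i # w) = adj i \<circ> braid_perm w"
  by (simp add: braid_perm_def)

lemma braid_perm_append: "braid_perm (u @ v) = braid_perm u \<circ> braid_perm v"
  by (induction u) (simp_all add: braid_perm_Cons braid_perm_def o_assoc)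

lemma braid_perm_snoc: "braid_perm (w @ [i]) = braid_perm w \<circ> adj i"
  by (simp add: braid_perm_append) (simp add: braid_perm_def)

lemma strand_at_eq_braid_perm:
  assumes "t \<le> length w"
  shows "strand_at w t = braid_perm (take t w)"
  using assms
proof (induction t)
  case 0
  then show ?case by (auto simp: braid_perm_def)
next
  case (Suc t)
  then have "take (Suc t) w = take t w @ [w ! t]"
    by (simp add: take_Suc_conv_app_nth)
  with Suc show ?case
    by (auto simp: braid_perm_snoc adj_def Transposition.transpose_def fun_eq_iff)
qed

lemma crossing_eq:
  assumes "t < length w"
  shows "crossing w t = braid_perm (take t w) ` {w ! t, w ! t + 1}"
  using assms by (simp add: crossing_def strand_at_eq_braid_perm)

lemma crossing_snoc: "t < length w \<Longrightarrow> crossing (w @ [i]) t = crossing w t"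
  by (simp add: crossing_eq nth_append)

lemma crossing_snoc_last: "crossing (w @ [i]) (length w) = braid_perm w ` {i, i + 1}"
  by (simp add: crossing_eq)

lemma flat_braid_snoc: "flat_braid (w @ [i]) \<longleftrightarrow> flat_braid w \<and> i \<in> {1, 2}"
  by (auto simp: flat_braid_def)

lemma flat_braid_take: "flat_braid w \<Longrightarrow> flat_braid (take t w)"
  using set_take_subset[of t w] unfolding flat_braid_def by blast

lemma permuted_neighbours_cases:
  assumes "p permutes {1..3}" and "i \<in> {1, 2::nat}"
  shows "p ` {i, i + 1} \<in> {{1, 2}, {2, 3}, {3, 1::nat}}"
proof -
  have "p i \<in> {1..3}" "p (i + 1) \<in> {1..3}"
    using assms(2) unfolding permutes_in_image[OF assms(1)] by auto
  moreover have "p i \<noteq> p (i + 1)"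
    using permutes_inj[OF assms(1)] by (simp add: inj_eq)
  ultimately have "p i \<in> {1, 2, 3} \<and> p (i + 1) \<in> {1, 2, 3} \<and> p i \<noteq> p (i + 1)"
    by auto
  then show ?thesis
    by (auto simp: doubleton_eq_iff)
qed

lemma crossing_cases:
  assumes "flat_braid w" and "t < length w"
  shows "crossing w t \<in> {{1, 2}, {2, 3}, {3, 1}}"
proof -
  have "w ! t \<in> {1, 2}"
    using assms(1) nth_mem[OF assms(2)] unfolding flat_braid_def by (rule subsetD)
  with braid_perm_permutes[OF flat_braid_take[OF assms(1)]] show ?thesis
    unfolding crossing_eq[OF assms(2)] by (rule permuted_neighbours_cases)
qed

section \<open>Inversions and the sign of a crossing\<close>

text \<open>
  The permutation sends a position to the label of the strand found there, so its inverse gives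
  the position of a strand.
\<close>

definition inverted :: "(nat \<Rightarrow> nat) \<Rightarrow> nat \<Rightarrow> nat \<Rightarrow> bool" where
  "inverted p a b \<longleftrightarrow> inv p b < inv p a"

lemma inverted_id: "inverted id a b \<longleftrightarrow> b < a"
  by (simp add: inverted_def)

lemma not_inverted_iff:
  assumes "bij p" and "a \<noteq> b"
  shows "\<not> inverted p a b \<longleftrightarrow> inv p a < inv p b"
proof -
  have "inv p a \<noteq> inv p b"
    using assms by (metis bij_inv_eq_iff)
  then show ?thesis
    by (auto simp: inverted_def)
qed

lemma image_neighbours_eq_iff:
  assumes "bij p"
  shows "p ` {i, i + 1} = {a, b} \<longleftrightarrow> {inv p a, inv p b} = {i, i + 1}"
proof -
  have "p ` {i, i + 1} = {a, b} \<longleftrightarrow> p ` {i, i + 1} = p ` {inv p a, inv p b}"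
    using assms by (simp add: bij_is_surj surj_f_inv_f)
  also have "\<dots> \<longleftrightarrow> {i, i + 1} = {inv p a, inv p b}"
    using assms by (intro inj_image_eq_iff bij_is_inj)
  finally show ?thesis by blast
qed

text \<open>
  No third position lies between two neighbouring ones, so exchanging their occupants affects
  no other pair.
\<close>

lemma inverted_comp_adj:
  assumes "bij p" and "a \<noteq> b"
  shows "inverted (p \<circ> adj i) a b \<longleftrightarrow> inverted p a b \<noteq> (p ` {i, i + 1} = {a, b})"
proof -
  have "bij (adj i)" "inv (adj i) = adj i"
    by (simp_all add: adj_def)
  then have pos: "inv (p \<circ> adj i) = adj i \<circ> inv p"
    using assms(1) by (simp add: o_inv_distrib)
  have "inv p a \<noteq> inv p b"
    using assms by (metis bij_inv_eq_iff)
  then have "adj i (inv p b) < adj i (inv p a) \<longleftrightarrow>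
      (inv p b < inv p a) \<noteq> ({inv p a, inv p b} = {i, i + 1})"
    by (auto simp: adj_def Transposition.transpose_def doubleton_eq_iff)
  then show ?thesis
    by (simp only: inverted_def pos comp_apply image_neighbours_eq_iff[OF assms(1)])
qed

text \<open>
  This is the parity of the arrangement, read off the cyclically oriented pairs; the pair
  \<open>(3, 1)\<close> is the only one that counts as inverted in the identity, which is why even length
  goes with an odd number of inversions.
\<close>

lemma even_length_iff_inversions:
  assumes "flat_braid w"
  shows "even (length w) \<longleftrightarrow>
    (inverted (braid_perm w) 1 2 \<longleftrightarrow> (inverted (braid_perm w) 2 3 \<longleftrightarrow> inverted (braid_perm w) 3 1))"
  using assms
proof (induction w rule: rev_induct)
  case Nil
  then show ?case by (simp add: braid_perm_def inverted_id flip: id_def)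
next
  case (snoc i w)
  let ?p = "braid_perm w"
  have w: "flat_braid w" and i: "i \<in> {1, 2}"
    using snoc.prems by (simp_all add: flat_braid_snoc)
  have perm: "?p permutes {1..3}"
    by (rule braid_perm_permutes[OF w])
  have step: "inverted (?p \<circ> adj i) a b \<longleftrightarrow> inverted ?p a b \<noteq> (?p ` {i, i + 1} = {a, b})"
    if "a \<noteq> b" for a b
    by (rule inverted_comp_adj[OF permutes_bij[OF perm] that])
  \<comment> \<open>The new crossing belongs to exactly one of the three pairs; only the parity of this count
    matters, and nested equivalences express it.\<close>
  have "?p ` {i, i + 1} = {1, 2} \<longleftrightarrow> (?p ` {i, i + 1} = {2, 3} \<longleftrightarrow> ?p ` {i, i + 1} = {3, 1})"
    using permuted_neighbours_cases[OF perm i] by (elim insertE emptyE) (simp_all only: doubleton_eq_iff, simp_all)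
  moreover have "(1::nat) \<noteq> 2" "(2::nat) \<noteq> 3" "(3::nat) \<noteq> 1"
    by simp_all
  moreover note step[OF this(1)] step[OF this(2)] step[OF this(3)]
  ultimately show ?case
    using snoc.IH[OF w] unfolding braid_perm_snoc length_append_singleton even_Suc by argo
qed

text \<open>
  Since the third strand \<open>c\<close> is on the same side of both \<open>a\<close> and \<open>b\<close>, exactly one of the
  oriented pairs \<open>(b, c)\<close> and \<open>(c, a)\<close> is inverted, whatever that side is.
\<close>

lemma inverted_third_strand:
  assumes "bij p" and "p ` {i, i + 1} = {a, b}" and "c \<noteq> a" and "c \<noteq> b"
  shows "inverted p b c \<noteq> inverted p c a"
proof -
  have "{inv p a, inv p b} = {i, i + 1}"
    using assms by (simp only: image_neighbours_eq_iff[OF assms(1)])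
  moreover have "inv p c \<noteq> inv p a" "inv p c \<noteq> inv p b"
    using assms by (metis bij_inv_eq_iff)+
  ultimately show ?thesis
    by (auto simp: inverted_def doubleton_eq_iff)
qed

lemma even_length_iff_not_inverted:
  assumes "flat_braid w"
    and "(a, b) \<in> {(1, 2), (2, 3), (3, 1)}"
    and "braid_perm w ` {i, i + 1} = {a, b}"
  shows "even (length w) \<longleftrightarrow> \<not> inverted (braid_perm w) a b"
proof -
  have "bij (braid_perm w)"
    by (rule permutes_bij[OF braid_perm_permutes[OF assms(1)]])
  note third = inverted_third_strand[OF this assms(3)]
  from assms(2) consider "a = 1" "b = 2" | "a = 2" "b = 3" | "a = 3" "b = 1"
    by auto
  then show ?thesis
  proof cases
    case 1
    then show ?thesis
      using third[of 3] by (auto simp: even_length_iff_inversions[OF assms(1)])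
  next
    case 2
    then show ?thesis
      using third[of 1] by (auto simp: even_length_iff_inversions[OF assms(1)])
  next
    case 3
    then show ?thesis
      using third[of 2] by (auto simp: even_length_iff_inversions[OF assms(1)])
  qed
qed

section \<open>Alternating sums over the crossings of a pair\<close>

definition pair_sum :: "nat list \<Rightarrow> nat set \<Rightarrow> int" where
  "pair_sum w P = (\<Sum>t<length w. of_bool (crossing w t = P) * (- 1) ^ t)"

lemma pair_sum_snoc:
  "pair_sum (w @ [i]) P =
    pair_sum w P + of_bool (braid_perm w ` {i, i + 1} = P) * (- 1) ^ length w"
proof -
  have "(\<Sum>t<length w. of_bool (crossing (w @ [i]) t = P) * (- 1) ^ t) = pair_sum w P"
    unfolding pair_sum_def by (intro sum.cong) (simp_all add: crossing_snoc)
  then show ?thesis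
    by (simp only: pair_sum_def length_append_singleton sum.lessThan_Suc crossing_snoc_last)
qed

text \<open>
  The sum telescopes: by the sign rule, the term of a crossing of \<open>a\<close> and \<open>b\<close> is the change of
  their inversion indicator at that crossing.
\<close>

lemma pair_sum_eq_inversion_change:
  assumes "flat_braid w" and "(a, b) \<in> {(1, 2), (2, 3), (3, 1)}"
  shows "pair_sum w {a, b} = of_bool (inverted (braid_perm w) a b) - of_bool (b < a)"
  using assms(1)
proof (induction w rule: rev_induct)
  case Nil
  then show ?case by (simp add: pair_sum_def braid_perm_def inverted_id flip: id_def)
next
  case (snoc i w)
  then have w: "flat_braid w"
    by (simp add: flat_braid_snoc)
  let ?p = "braid_perm w"
  have "a \<noteq> b"
    using assms(2) by auto
  then have step: "inverted (?p \<circ> adj i) a b \<longleftrightarrow> inverted ?p a b \<noteq> (?p ` {i, i + 1} = {a, b})"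
    by (intro inverted_comp_adj permutes_bij[OF braid_perm_permutes[OF w]])
  show ?case
  proof (cases "?p ` {i, i + 1} = {a, b}")
    case True
    have "(- 1 :: int) ^ length w = (if inverted ?p a b then - 1 else 1)"
      using even_length_iff_not_inverted[OF w assms(2) True] by (auto simp: minus_one_power_iff)
    then show ?thesis
      using snoc.IH[OF w] step True by (simp only: pair_sum_snoc braid_perm_snoc) auto
  next
    case False
    then show ?thesis
      using snoc.IH[OF w] step by (simp only: pair_sum_snoc braid_perm_snoc) auto
  qed
qed

lemma pair_sum_cong:
  assumes "flat_braid w" and "flat_braid w'" and "braid_equal w w'"
    and "P \<in> {{1, 2}, {2, 3}, {3, 1}}"
  shows "pair_sum w P = pair_sum w' P"
proof -
  from assms(4) obtain a b where "P = {a, b}" and "(a, b) \<in> {(1, 2), (2, 3), (3, 1)}"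
    by blast
  then show ?thesis
    using assms(1-3) by (simp only: pair_sum_eq_inversion_change braid_equal_def)
qed

lemma trivial_braid_iff_pair_sums:
  assumes "flat_braid w"
  shows "trivial_braid w \<longleftrightarrow> pair_sum w {1, 2} = 0 \<and> pair_sum w {2, 3} = 0 \<and> pair_sum w {3, 1} = 0"
proof
  assume "trivial_braid w"
  then show "pair_sum w {1, 2} = 0 \<and> pair_sum w {2, 3} = 0 \<and> pair_sum w {3, 1} = 0"
    using assms by (simp add: pair_sum_eq_inversion_change trivial_braid_def inverted_id)
next
  let ?p = "braid_perm w"
  assume "pair_sum w {1, 2} = 0 \<and> pair_sum w {2, 3} = 0 \<and> pair_sum w {3, 1} = 0"
  then have "\<not> inverted ?p 1 2" "\<not> inverted ?p 2 3"
    using assms by (simp_all add: pair_sum_eq_inversion_change)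
  moreover have perm: "?p permutes {1..3}"
    by (rule braid_perm_permutes[OF assms])
  ultimately have less: "inv ?p 1 < inv ?p 2" "inv ?p 2 < inv ?p 3"
    using not_inverted_iff[OF permutes_bij[OF perm], of 1 2]
      not_inverted_iff[OF permutes_bij[OF perm], of 2 3] by simp_all
  have inv_perm: "inv ?p permutes {1..3}"
    by (rule permutes_inv[OF perm])
  have "inv ?p 1 \<in> {1..3}" "inv ?p 3 \<in> {1..3}"
    unfolding permutes_in_image[OF inv_perm] by simp_all
  with less have fixed: "inv ?p 1 = 1" "inv ?p 2 = 2" "inv ?p 3 = 3"
    by auto
  have "inv ?p x = x" for x
  proof (cases "x \<in> {1..3}")
    case True
    then have "x = 1 \<or> x = 2 \<or> x = 3"
      by auto
    with fixed show ?thesis by auto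
  next
    case False
    then show ?thesis by (rule permutes_not_in[OF inv_perm])
  qed
  then have "inv ?p = id"
    by auto
  then show "trivial_braid w"
    using perm by (metis trivial_braid_def permutes_inv_inv inv_id)
qed

section \<open>The columns of alternating row sums\<close>

definition column_of_triple :: "int \<Rightarrow> int \<Rightarrow> int \<Rightarrow> int mat" where
  "column_of_triple x y z = mat 3 1 (\<lambda>(r, _). [x, y, z] ! r)"

lemma column_of_triple_eq_0_iff:
  "column_of_triple x y z = 0\<^sub>m 3 1 \<longleftrightarrow> x = 0 \<and> y = 0 \<and> z = 0"
proof
  assume "column_of_triple x y z = 0\<^sub>m 3 1"
  then have "column_of_triple x y z $$ (r, 0) = 0" if "r < 3" for r
    using that by simp
  from this[of 0] this[of 1] this[of 2] show "x = 0 \<and> y = 0 \<and> z = 0"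
    by (simp add: column_of_triple_def)
next
  assume "x = 0 \<and> y = 0 \<and> z = 0"
  moreover have "r < 3 \<Longrightarrow> r = 0 \<or> r = 1 \<or> r = 2" for r :: nat
    by linarith
  ultimately show "column_of_triple x y z = 0\<^sub>m 3 1"
    by (intro eq_matI) (fastforce simp: column_of_triple_def)+
qed

lemma mat_mult_alt_col_eq_column_of_triple:
  assumes "\<And>r. r < 3 \<Longrightarrow> (\<Sum>t<k. f (r, t) * (- 1) ^ t) = [x, y, z] ! r"
  shows "mat 3 k f * alt_col k = column_of_triple x y z"
proof (rule eq_matI)
  fix r j assume "r < dim_row (column_of_triple x y z)" "j < dim_col (column_of_triple x y z)"
  then have "r < 3" "j = 0"
    by (simp_all add: column_of_triple_def)
  then show "(mat 3 k f * alt_col k) $$ (r, j) = column_of_triple x y z $$ (r, j)"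
    using assms[of r]
    by (simp add: column_of_triple_def alt_col_def scalar_prod_def lessThan_atLeast0)
qed (simp_all add: column_of_triple_def alt_col_def)

lemma ES1_alt_col:
  "ES1 w * alt_col (length w) =
    column_of_triple (pair_sum w {1, 2}) (pair_sum w {2, 3}) (pair_sum w {3, 1})"
  unfolding ES1_def
proof (rule mat_mult_alt_col_eq_column_of_triple)
  fix r :: nat assume "r < 3"
  then have "r = 0 \<or> r = 1 \<or> r = 2"
    by linarith
  then show "(\<Sum>t<length w.
      (case (r, t) of (r, t) \<Rightarrow> if crossing w t = [{1, 2}, {2, 3}, {3, 1}] ! r then 1 else 0)
        * (- 1) ^ t) =
      [pair_sum w {1, 2}, pair_sum w {2, 3}, pair_sum w {3, 1}] ! r"
    by (auto simp: pair_sum_def of_bool_def)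
qed

text \<open>Each strand belongs to two of the three pairs, and takes part in the crossings of both.\<close>

lemma ES2_alt_col:
  assumes "flat_braid w"
  shows "ES2 w * alt_col (length w) =
    column_of_triple (pair_sum w {3, 1} + pair_sum w {1, 2})
      (pair_sum w {1, 2} + pair_sum w {2, 3}) (pair_sum w {2, 3} + pair_sum w {3, 1})"
  unfolding ES2_def
proof (rule mat_mult_alt_col_eq_column_of_triple)
  fix r :: nat assume "r < 3"
  then have r: "r = 0 \<or> r = 1 \<or> r = 2"
    by linarith
  have strand_sum: "(\<Sum>t<length w. (if c \<in> crossing w t then 1 else 0) * (- 1) ^ t) =
      pair_sum w {a, c} + pair_sum w {c, b}"
    if "(a, c, b) \<in> {(3, 1, 2), (1, 2, 3), (2, 3, 1)}" for a b c
  proof -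
    have entry: "(if c \<in> crossing w t then 1 else 0) =
        of_bool (crossing w t = {a, c}) + (of_bool (crossing w t = {c, b}) :: int)"
      if "t < length w" for t
    proof -
      have "\<exists>P \<in> {{1, 2}, {2, 3}, {3, 1}}. crossing w t = P"
        using crossing_cases[OF assms that] by blast
      then show ?thesis
        using \<open>(a, c, b) \<in> _\<close> by (auto simp: doubleton_eq_iff)
    qed
    have "(\<Sum>t<length w. (if c \<in> crossing w t then 1 else 0) * (- 1) ^ t) =
        (\<Sum>t<length w. of_bool (crossing w t = {a, c}) * (- 1) ^ t +
          of_bool (crossing w t = {c, b}) * (- 1 :: int) ^ t)"
      by (intro sum.cong refl) (simp only: lessThan_iff entry distrib_right)
    then show ?thesis
      by (simp only: pair_sum_def sum.distrib)
  qed
  show "(\<Sum>t<length w.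
      (case (r, t) of (r, t) \<Rightarrow> if r + 1 \<in> crossing w t then 1 else 0) * (- 1) ^ t) =
      [pair_sum w {3, 1} + pair_sum w {1, 2}, pair_sum w {1, 2} + pair_sum w {2, 3},
        pair_sum w {2, 3} + pair_sum w {3, 1}] ! r"
    using r strand_sum[of 3 1 2] strand_sum[of 1 2 3] strand_sum[of 2 3 1]
    by (auto simp: numeral_2_eq_2 numeral_3_eq_3)
qed

theorem theorem3:
  fixes ES :: "nat list \<Rightarrow> int mat"
  assumes "ES = ES2 \<or> ES = ES1"
  shows "(\<forall>w w' k k'. flat_braid w \<and> length w = k \<and> flat_braid w' \<and> length w' = k' \<and> braid_equal w w'
            \<longrightarrow> ES w * alt_col k = ES w' * alt_col k') \<and>
         (\<forall>w k. flat_braid w \<and> length w = k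
            \<longrightarrow> (trivial_braid w \<longleftrightarrow> ES w * alt_col k = 0\<^sub>m 3 1))"
proof (intro conjI allI impI; elim conjE)
  fix w w' :: "nat list" and k k' :: nat
  assume w: "flat_braid w" "flat_braid w'" "braid_equal w w'"
    and k: "length w = k" "length w' = k'"
  have "pair_sum w {1, 2} = pair_sum w' {1, 2}" "pair_sum w {2, 3} = pair_sum w' {2, 3}"
      "pair_sum w {3, 1} = pair_sum w' {3, 1}"
    by (rule pair_sum_cong[OF w], blast)+
  then show "ES w * alt_col k = ES w' * alt_col k'"
    using assms unfolding k[symmetric]
    by (elim disjE) (simp_all only: ES1_alt_col ES2_alt_col[OF w(1)] ES2_alt_col[OF w(2)])
next
  fix w :: "nat list" and k :: nat
  assume w: "flat_braid w" and k: "length w = k"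
  \<comment> \<open>For \<open>ES2\<close>: if the sums of any two of three integers vanish, each equals its own negative.\<close>
  have "ES w * alt_col k = 0\<^sub>m 3 1 \<longleftrightarrow>
      pair_sum w {1, 2} = 0 \<and> pair_sum w {2, 3} = 0 \<and> pair_sum w {3, 1} = 0"
    using assms unfolding k[symmetric]
    by (elim disjE)
      (simp_all only: ES1_alt_col ES2_alt_col[OF w] column_of_triple_eq_0_iff, linarith)
  then show "trivial_braid w \<longleftrightarrow> ES w * alt_col k = 0\<^sub>m 3 1"
    by (simp only: trivial_braid_iff_pair_sums[OF w])
qed

end
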